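(* Assume: (i) there exists $R_{\max}<\infty$ such that $|R(s,a)|\le R_{\max}$ almost surely for all $(s,a)\in\mathcal S\times\mathcal A$; (ii) for any return-distribution field $\mathcal Z$ with $F_{\mathcal Z}\in\mathcal X^{\mathrm{cdf}}$ and each $x\in\mathbb R$, the map $(s,a)\mapsto \mathbb E_{(s',a')\sim\mathcal P^\pi(\cdot\mid s,a)}[F_{\mathcal Z(s',a')}(x)]$ is measurable. Then the CDF Bellman operator $$\mathcal T^\pi_{\mathrm{cdf}}=\mathcal C^\pi\circ\mathcal D_\gamma\circ\mathcal S_R$$ is a $\sqrt\gamma$-contraction on the metric space $(\mathcal X^{\mathrm{cdf}},d_{\mathrm{Cr}})$: for any return-distribution fields $\mathcal Z_1,\mathcal Z_2$ with $F_{\mathcal Z_1},F_{\mathcal Z_2}\in\mathcal X^{\mathrm{cdf}}$, $$d_{\mathrm{Cr}}\bigl(\mathcal T^\pi_{\mathrm{cdf}}F_{\mathcal Z_1},\mathcal T^\pi_{\mathrm{cdf}}F_{\mathcal Z_2}\bigr)\le\sqrt\gamma\; d_{\mathrm{Cr}}\bigl(F_{\mathcal Z_1},F_{\mathcal Z_2}\bigr).$$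
   Context: MDP. $\mathcal S$ is the state space, $\mathcal A$ the action space, $\gamma\in(0,1)$ the discount factor, $\mathcal P(\cdot\mid s,a)$ a transition kernel on $\mathcal S$, $\mathcal R(s,a,s')\in\mathbb R$ a reward function, and $\pi$ a fixed stationary policy (stochastic kernel on $\mathcal A$ given $\mathcal S$). $\mathcal P^\pi(\cdot\mid s,a)$ is the law of $(s',a')$ obtained by sampling $s'\sim\mathcal P(\cdot\mid s,a)$ and then $a'\sim\pi(\cdot\mid s')$. $R(s,a)$ is the one-step reward random variable: sample $S'\sim\mathcal P(\cdot\mid s,a)$ and set $R(s,a)=\mathcal R(s,a,S')$. CDF fields. $F_P$ is the cumulative distribution function (CDF) of a probability law $P$ on $\mathbb R$; $F_{\delta_0}(x)=\mathbf 1\{x\ge0\}$. $\Gamma_F$ is the set of CDFs $F$ with $F-F_{\delta_0}\in L^2(\mathbb R)$. A return-distribution field is a map $\mathcal Z$ assigning to each $(s,a)\in\mathcal S\times\mathcal A$ a probability law $\mathcal Z(s,a)$ on $\mathbb R$; its CDF field $F_{\mathcal Z}$ is $(s,a)\mapsto F_{\mathcal Z}(s,a):=F_{\mathcal Z(s,a)}$. $\mathcal X^{\mathrm{cdf}}$ is the set of CDF fields $F_{\mathcal Z}$ with $F_{\mathcal Z(s,a)}\in\Gamma_F$ for all $(s,a)$. The metric is $d_{\mathrm{Cr}}(F_{\mathcal Z_1},F_{\mathcal Z_2})=\sup_{(s,a)}\bigl(\int_{\mathbb R}(F_{\mathcal Z_1(s,a)}(x)-F_{\mathcal Z_2(s,a)}(x))^2dx\bigr)^{1/2}$.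 Operators on CDF fields. Reward translation: $(\mathcal S_RF_{\mathcal Z})(s,a)(x):=\mathbb E_{r\sim R(s,a)}[F_{\mathcal Z(s,a)}(x-r)]$. Discount scaling: $(\mathcal D_\gamma F_{\mathcal Z})(s,a)(x):=F_{\mathcal Z(s,a)}(x/\gamma)$. Conditional expectation: $(\mathcal C^\pi F_{\mathcal Z})(s,a)(x):=\mathbb E_{(s',a')\sim\mathcal P^\pi(\cdot\mid s,a)}[F_{\mathcal Z(s',a')}(x)]$. CDF Bellman operator: $\mathcal T^\pi_{\mathrm{cdf}}:=\mathcal C^\pi\circ\mathcal D_\gamma\circ\mathcal S_R$; the source writes this equivalently as $(\mathcal T^\pi_{\mathrm{cdf}}F_{\mathcal Z})(s,a)(x)=\mathbb E_{r,(s',a')}\bigl[F_{\mathcal Z(s',a')}\bigl(\tfrac{x-r}{\gamma}\bigr)\bigr]$, where $r\sim R(s,a)$ and $(s',a')\sim\mathcal P^\pi(\cdot\mid s,a)$.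
   Formalization: The distance may be infinite and the operator need not map the CDF-field space into itself under (i)–(ii), so only the displayed inequality is stated; (ii) includes existence of the expectations; the operator is the displayed composition, not the source's "equivalent" formula. *)

theory Defs
  imports "HOL-Probability.Probability"
begin

(* S and A carry the state and action spaces with their sigma-algebras; state-action pairs
   range over space (S \<Otimes>\<^sub>M A), and values of fields and kernels outside it are irrelevant. *)

type_synonym ('s, 'a) field = "'s \<times> 'a \<Rightarrow> real \<Rightarrow> real"

definition next_pair_law ::
  "'s measure \<Rightarrow> 'a measure \<Rightarrow> ('s \<times> 'a \<Rightarrow> 's measure) \<Rightarrow> ('s \<Rightarrow> 'a measure)
     \<Rightarrow> 's \<times> 'a \<Rightarrow> ('s \<times> 'a) measure" where
  "next_pair_law S A P \<pi> z =
     P z \<bind> (\<lambda>s'. \<pi> s' \<bind> (\<lambda>a'. return (S \<Otimes>\<^sub>M A) (s', a')))"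

definition reward_law ::
  "('s \<times> 'a \<Rightarrow> 's measure) \<Rightarrow> ('s \<times> 'a \<Rightarrow> 's \<Rightarrow> real) \<Rightarrow> 's \<times> 'a \<Rightarrow> real measure" where
  "reward_law P R z = distr (P z) borel (R z)"

definition Gamma_F :: "(real \<Rightarrow> real) set" where
  "Gamma_F = {F. (\<exists>M. real_distribution M \<and> F = cdf M) \<and>
                 integrable lborel (\<lambda>x. (F x - cdf (return borel 0) x)\<^sup>2)}"

definition return_dist_field ::
  "'s measure \<Rightarrow> 'a measure \<Rightarrow> ('s \<times> 'a \<Rightarrow> real measure) \<Rightarrow> bool" where
  "return_dist_field S A Z \<longleftrightarrow> (\<forall>z \<in> space (S \<Otimes>\<^sub>M A). real_distribution (Z z))"

definition cdf_field :: "('s \<times> 'a \<Rightarrow> real measure) \<Rightarrow> ('s, 'a) field" where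
  "cdf_field Z = (\<lambda>z. cdf (Z z))"

definition X_cdf :: "'s measure \<Rightarrow> 'a measure \<Rightarrow> ('s, 'a) field set" where
  "X_cdf S A = {cdf_field Z | Z. return_dist_field S A Z \<and>
                                 (\<forall>z \<in> space (S \<Otimes>\<^sub>M A). cdf_field Z z \<in> Gamma_F)}"

definition ennreal_sqrt :: "ennreal \<Rightarrow> ennreal" where
  "ennreal_sqrt t = (if t = \<infinity> then \<infinity> else ennreal (sqrt (enn2real t)))"

(* Extended-valued: each L2 distance between members of Gamma_F is finite, but the supremum
   over an infinite state-action space need not be. *)
definition d_Cr ::
  "'s measure \<Rightarrow> 'a measure \<Rightarrow> ('s, 'a) field \<Rightarrow> ('s, 'a) field \<Rightarrow> ennreal" where
  "d_Cr S A F G = (SUP z \<in> space (S \<Otimes>\<^sub>M A).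
     ennreal_sqrt (\<integral>\<^sup>+ x. ennreal ((F z x - G z x)\<^sup>2) \<partial>lborel))"

definition reward_translation ::
  "('s \<times> 'a \<Rightarrow> 's measure) \<Rightarrow> ('s \<times> 'a \<Rightarrow> 's \<Rightarrow> real)
     \<Rightarrow> ('s, 'a) field \<Rightarrow> ('s, 'a) field" where
  "reward_translation P R F = (\<lambda>z x. \<integral> r. F z (x - r) \<partial>reward_law P R z)"

definition discount_scaling :: "real \<Rightarrow> ('s, 'a) field \<Rightarrow> ('s, 'a) field" where
  "discount_scaling \<gamma> F = (\<lambda>z x. F z (x / \<gamma>))"

definition cond_expectation ::
  "'s measure \<Rightarrow> 'a measure \<Rightarrow> ('s \<times> 'a \<Rightarrow> 's measure) \<Rightarrow> ('s \<Rightarrow> 'a measure)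
     \<Rightarrow> ('s, 'a) field \<Rightarrow> ('s, 'a) field" where
  "cond_expectation S A P \<pi> F = (\<lambda>z x. \<integral> z'. F z' x \<partial>next_pair_law S A P \<pi> z)"

(* In this order of composition the reward law is evaluated at the next pair and the translation
   acts before the scaling:
   the value at z and x is the mean, over next pairs z' and rewards r at z', of F z' (x / \<gamma> - r). *)
definition cdf_bellman ::
  "'s measure \<Rightarrow> 'a measure \<Rightarrow> ('s \<times> 'a \<Rightarrow> 's measure) \<Rightarrow> ('s \<times> 'a \<Rightarrow> 's \<Rightarrow> real)
     \<Rightarrow> ('s \<Rightarrow> 'a measure) \<Rightarrow> real \<Rightarrow> ('s, 'a) field \<Rightarrow> ('s, 'a) field" where
  "cdf_bellman S A P R \<pi> \<gamma> =
     cond_expectation S A P \<pi> \<circ> discount_scaling \<gamma> \<circ> reward_translation P R"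

end

theory Submission
  imports Defs
begin

text \<open>
  The integrability hypothesis ranges over all return-distribution fields, so it can be tested on
  fields that take the two values \<open>\<delta>\<^sub>0\<close> and \<open>\<delta>\<^sub>1\<close>: it forces every set of state-action pairs to be
  measurable, hence makes the reward laws a kernel. Averaging over next pairs and over rewards does
  not increase the squared \<open>L\<^sup>2\<close> norm, by Jensen's inequality and Tonelli's theorem; translation by
  a reward preserves it, and the substitution \<open>x = \<gamma> y\<close> contributes the factor \<open>\<gamma>\<close>.
\<close>

section \<open>Extended square roots, joint measurability and mean-square inequalities\<close>

lemma ennreal_sqrt_mono: "s \<le> t \<Longrightarrow> ennreal_sqrt s \<le> ennreal_sqrt t"
  by (cases s; cases t) (auto simp: ennreal_sqrt_def top_unique)

lemma ennreal_sqrt_power2: "(ennreal_sqrt t)\<^sup>2 = t"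
  by (cases t) (auto simp: ennreal_sqrt_def ennreal_power power_eq_top_ennreal)

text \<open>Turns the bound on squared distances into one on distances. \<open>D\<close> may be
  infinite, as a supremum over pairs can be.\<close>

lemma ennreal_sqrt_mult_power2:
  assumes "0 < c"
  shows "ennreal_sqrt (ennreal c * D\<^sup>2) = ennreal (sqrt c) * D"
  using assms
  by (cases D) (auto simp: ennreal_sqrt_def ennreal_power ennreal_mult[symmetric] real_sqrt_mult
      power2_eq_square ennreal_mult_top ennreal_top_mult)

text \<open>By right continuity \<open>f\<close> is the pointwise limit of functions that evaluate
  the second argument only on a countable grid, and these are jointly measurable.\<close>

lemma borel_measurable_pair_right_continuous:
  fixes f :: "'z \<Rightarrow> real \<Rightarrow> real"
  assumes meas: "\<And>x. (\<lambda>z. f z x) \<in> borel_measurable M"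
    and cont: "\<And>z x. z \<in> space M \<Longrightarrow> continuous (at_right x) (f z)"
  shows "(\<lambda>(z, x). f z x) \<in> borel_measurable (M \<Otimes>\<^sub>M borel)"
proof -
  \<comment> \<open>The first point of the grid of mesh \<open>1 / Suc n\<close> strictly to the
    right of \<open>x\<close>. The \<open>+ 1\<close> keeps it strict when \<open>x\<close> lies on
    the grid, as \<open>at_right x\<close> excludes \<open>x\<close>.\<close>
  define a where "a n x = (real_of_int \<lfloor>real (Suc n) * x\<rfloor> + 1) / real (Suc n)" for n x
  have gt: "x < a n x" for n x
    using floor_correct[of "real (Suc n) * x"] by (simp add: a_def field_simps)
  have le: "a n x \<le> x + 1 / real (Suc n)" for n x
  proof -
    have "a n x \<le> (real (Suc n) * x + 1) / real (Suc n)"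
      unfolding a_def by (intro divide_right_mono add_right_mono of_int_floor_le) simp
    then show ?thesis
      by (simp add: add_divide_distrib del: of_nat_Suc)
  qed
  have a_lim: "(\<lambda>n. a n x) \<longlonglongrightarrow> x" for x
  proof (rule tendsto_sandwich)
    show "\<forall>\<^sub>F n in sequentially. x \<le> a n x" "\<forall>\<^sub>F n in sequentially. a n x \<le> x + 1 / real (Suc n)"
      using gt le by (auto intro: always_eventually less_imp_le)
    show "(\<lambda>n. x + 1 / real (Suc n)) \<longlonglongrightarrow> x"
      using tendsto_add[OF tendsto_const LIMSEQ_Suc[OF lim_1_over_n]] by fastforce
  qed simp
  show ?thesis
  proof (rule borel_measurable_LIMSEQ_real)
    fix p assume "p \<in> space (M \<Otimes>\<^sub>M (borel :: real measure))"
    then obtain z x where p: "p = (z, x)" "z \<in> space M"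
      by (auto simp: space_pair_measure)
    have "filterlim (\<lambda>n. a n x) (at_right x) sequentially"
      using gt a_lim by (intro tendsto_imp_filterlim_at_right) (auto intro!: always_eventually)
    then show "(\<lambda>n. case p of (z, x) \<Rightarrow> f z (a n x)) \<longlonglongrightarrow> (case p of (z, x) \<Rightarrow> f z x)"
      using cont[OF p(2), of x] p by (auto simp: continuous_within intro: filterlim_compose)
  next
    fix n
    \<comment> \<open>With the grid index \<open>i\<close> fixed, only the first argument varies;
      the countably many indices are then glued together.\<close>
    have "(\<lambda>p. f (fst p) ((real_of_int i + 1) / real (Suc n))) \<in> borel_measurable (M \<Otimes>\<^sub>M borel)" for i
      using meas by measurable
    then have "(\<lambda>p. f (fst p) ((real_of_int \<lfloor>real (Suc n) * snd p\<rfloor> + 1) / real (Suc n)))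
        \<in> borel_measurable (M \<Otimes>\<^sub>M borel)"
      by (rule measurable_compose_countable) measurable
    then show "(\<lambda>(z, x). f z (a n x)) \<in> borel_measurable (M \<Otimes>\<^sub>M borel)"
      by (simp add: a_def case_prod_beta)
  qed
qed

text \<open>Nonnegativity of the variance. An infinite second moment makes the bound trivial, and a
  finite one forces \<open>f\<close> to be integrable.\<close>

lemma (in prob_space) power2_expectation_le:
  fixes f :: "'a \<Rightarrow> real"
  assumes f[measurable]: "f \<in> borel_measurable M"
  shows "ennreal ((\<integral>x. f x \<partial>M)\<^sup>2) \<le> (\<integral>\<^sup>+ x. ennreal ((f x)\<^sup>2) \<partial>M)"
proof (cases "(\<integral>\<^sup>+ x. ennreal ((f x)\<^sup>2) \<partial>M) = \<infinity>")
  case False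
  then have sq: "integrable M (\<lambda>x. (f x)\<^sup>2)"
    by (intro integrableI_nonneg) (auto simp: top.not_eq_extremum)
  then have int: "integrable M f"
    using f square_integrable_imp_integrable by blast
  have "(\<integral>x. f x \<partial>M)\<^sup>2 \<le> (\<integral>x. (f x)\<^sup>2 \<partial>M)"
    using variance_positive[of f] variance_eq[OF int sq] by simp
  then show ?thesis
    by (simp add: nn_integral_eq_integral[OF sq] ennreal_leI)
qed simp

lemma nn_integral_power2_mean_le:
  fixes f :: "'z \<Rightarrow> real \<Rightarrow> real"
  assumes "prob_space M" and f[measurable]: "(\<lambda>(z, x). f z x) \<in> borel_measurable (M \<Otimes>\<^sub>M borel)"
  shows "(\<integral>\<^sup>+ x. ennreal ((\<integral>z. f z x \<partial>M)\<^sup>2) \<partial>lborel)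
    \<le> (\<integral>\<^sup>+ z. (\<integral>\<^sup>+ x. ennreal ((f z x)\<^sup>2) \<partial>lborel) \<partial>M)"
proof -
  interpret prob_space M by fact
  interpret pair_sigma_finite M lborel ..
  have "(\<integral>\<^sup>+ x. ennreal ((\<integral>z. f z x \<partial>M)\<^sup>2) \<partial>lborel)
      \<le> (\<integral>\<^sup>+ x. (\<integral>\<^sup>+ z. ennreal ((f z x)\<^sup>2) \<partial>M) \<partial>lborel)"
    by (intro nn_integral_mono power2_expectation_le) measurable
  also have "\<dots> = (\<integral>\<^sup>+ z. (\<integral>\<^sup>+ x. ennreal ((f z x)\<^sup>2) \<partial>lborel) \<partial>M)"
    by (intro Fubini') measurable
  finally show ?thesis .
qed

text \<open>After the exchange of integrals the inner one does not depend on \<open>r\<close>, since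
  Lebesgue measure is translation invariant, and \<open>M\<close> has mass 1.\<close>

lemma nn_integral_power2_translation_mean_le:
  fixes g :: "real \<Rightarrow> real"
  assumes "real_distribution M" and g[measurable]: "g \<in> borel_measurable borel"
  shows "(\<integral>\<^sup>+ x. ennreal ((\<integral>r. g (x - r) \<partial>M)\<^sup>2) \<partial>lborel) \<le> (\<integral>\<^sup>+ x. ennreal ((g x)\<^sup>2) \<partial>lborel)"
proof -
  interpret real_distribution M by fact
  have shift: "(\<integral>\<^sup>+ x. ennreal ((g (x - r))\<^sup>2) \<partial>lborel) = (\<integral>\<^sup>+ x. ennreal ((g x)\<^sup>2) \<partial>lborel)" for r
    using nn_integral_real_affine[of "\<lambda>x. ennreal ((g x)\<^sup>2)" 1 "- r"] by simp
  have "(\<integral>\<^sup>+ x. ennreal ((\<integral>r. g (x - r) \<partial>M)\<^sup>2) \<partial>lborel)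
      \<le> (\<integral>\<^sup>+ r. (\<integral>\<^sup>+ x. ennreal ((g (x - r))\<^sup>2) \<partial>lborel) \<partial>M)"
    by (intro nn_integral_power2_mean_le prob_space_axioms) measurable
  also have "\<dots> = (\<integral>\<^sup>+ r. (\<integral>\<^sup>+ x. ennreal ((g x)\<^sup>2) \<partial>lborel) \<partial>M)"
    by (simp only: shift)
  finally show ?thesis
    using emeasure_space_1 by simp
qed

text \<open>Pushing \<open>L x\<close> forward along \<open>Pair x\<close> moves the dependence on
  \<open>x\<close> from the integrand into the kernel, so that a fixed function on the product is
  integrated.\<close>

lemma integral_measurable_subprob_algebra2:
  fixes f :: "'z \<Rightarrow> 'b \<Rightarrow> real"
  assumes f[measurable]: "(\<lambda>(x, y). f x y) \<in> borel_measurable (M \<Otimes>\<^sub>M N)"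
    and L[measurable]: "L \<in> M \<rightarrow>\<^sub>M subprob_algebra N"
  shows "(\<lambda>x. \<integral> y. f x y \<partial>L x) \<in> borel_measurable M"
proof -
  note measurable_distr2[measurable]
  have "(\<lambda>x. \<integral> p. (case p of (x, y) \<Rightarrow> f x y) \<partial>distr (L x) (M \<Otimes>\<^sub>M N) (Pair x)) \<in> borel_measurable M"
    by measurable
  then show ?thesis
    by (rule measurable_cong[THEN iffD1, rotated]) (simp add: integral_distr)
qed

section \<open>Two-valued test fields and discreteness of the sigma-algebra\<close>

lemma cdf_return: "cdf (return borel a) x = (if a \<le> x then 1 else 0)"
  by (simp add: cdf_def measure_return)

lemma real_distribution_return: "real_distribution (return borel a)"
  by (simp add: real_distribution_def real_distribution_axioms_def prob_space_return)

lemma cdf_return_in_Gamma_F: "cdf (return borel a) \<in> Gamma_F"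
proof -
  have "integrable lborel (\<lambda>x. (cdf (return borel a) x - cdf (return borel 0) x)\<^sup>2)"
  proof (rule Bochner_Integration.integrable_bound)
    \<comment> \<open>The two step functions differ only between 0 and \<open>a\<close>; the
      symmetric interval covers both signs of \<open>a\<close>.\<close>
    show "integrable lborel (indicator {- \<bar>a\<bar>..\<bar>a\<bar>} :: real \<Rightarrow> real)"
      by simp
  qed (auto simp: cdf_return indicator_def)
  then show ?thesis
    unfolding Gamma_F_def using real_distribution_return by blast
qed

lemma next_pair_law_in_prob_algebra:
  assumes "P \<in> S \<Otimes>\<^sub>M A \<rightarrow>\<^sub>M prob_algebra S" "\<pi> \<in> S \<rightarrow>\<^sub>M prob_algebra A"
    and "z \<in> space (S \<Otimes>\<^sub>M A)"
  shows "next_pair_law S A P \<pi> z \<in> space (prob_algebra (S \<Otimes>\<^sub>M A))"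
proof -
  note assms(1,2)[measurable]
  have "next_pair_law S A P \<pi> \<in> S \<Otimes>\<^sub>M A \<rightarrow>\<^sub>M prob_algebra (S \<Otimes>\<^sub>M A)"
    unfolding next_pair_law_def
    by (intro measurable_bind_prob_space2[where N=S] measurable_bind_prob_space2[where N=A]) measurable
  then show ?thesis
    using assms(3) by (rule measurable_space)
qed

text \<open>Membership in \<open>X_cdf\<close> imposes no measurability in the pair, while
  integrability includes it; so the indicator of an arbitrary set, realised as a CDF field at a
  point, must be measurable.\<close>

lemma sets_eq_Pow_if_fields_integrable:
  assumes "P \<in> S \<Otimes>\<^sub>M A \<rightarrow>\<^sub>M prob_algebra S" "\<pi> \<in> S \<rightarrow>\<^sub>M prob_algebra A"
    and int: "\<And>Z x z. return_dist_field S A Z \<Longrightarrow> cdf_field Z \<in> X_cdf S A \<Longrightarrow>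
      z \<in> space (S \<Otimes>\<^sub>M A) \<Longrightarrow> integrable (next_pair_law S A P \<pi> z) (\<lambda>z'. cdf_field Z z' x)"
  shows "sets (S \<Otimes>\<^sub>M A) = Pow (space (S \<Otimes>\<^sub>M A))"
proof (intro equalityI subsetI)
  fix B assume "B \<in> Pow (space (S \<Otimes>\<^sub>M A))"
  then have B: "B \<subseteq> space (S \<Otimes>\<^sub>M A)" by simp
  show "B \<in> sets (S \<Otimes>\<^sub>M A)"
  proof (cases "B = {}")
    case False
    \<comment> \<open>The hypothesis speaks about next-pair laws at actual pairs, so one pair is
      needed to invoke it.\<close>
    then obtain z where z: "z \<in> space (S \<Otimes>\<^sub>M A)" using B by blast
    \<comment> \<open>At 0 the CDF of the point mass at 0 is 1 and that of the point mass at 1 is 0,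
      so the field evaluated at 0 is the indicator of \<open>B\<close>.\<close>
    define Z where "Z z = return borel (if z \<in> B then 0 else 1 :: real)" for z
    have Z: "return_dist_field S A Z"
      by (simp add: return_dist_field_def Z_def real_distribution_return)
    then have "cdf_field Z \<in> X_cdf S A"
      unfolding X_cdf_def using cdf_return_in_Gamma_F
      by (intro CollectI exI[of _ Z]) (auto simp: cdf_field_def Z_def)
    from int[OF Z this z, of 0] have "(\<lambda>z'. cdf_field Z z' 0) \<in> borel_measurable (S \<Otimes>\<^sub>M A)"
      using next_pair_law_in_prob_algebra[OF assms(1,2) z]
      by (auto dest!: borel_measurable_integrable simp: space_prob_algebra cong: measurable_cong_sets)
    then have "(\<lambda>z'. cdf_field Z z' 0) -` {1} \<inter> space (S \<Otimes>\<^sub>M A) \<in> sets (S \<Otimes>\<^sub>M A)"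
      by (rule measurable_sets) simp
    also have "(\<lambda>z'. cdf_field Z z' 0) -` {1} \<inter> space (S \<Otimes>\<^sub>M A) = B"
      using B by (auto simp: cdf_field_def Z_def cdf_return split: if_splits)
    finally show ?thesis .
  qed simp
qed (use sets.sets_into_space in blast)

theorem theorem25:
  fixes S :: "'s measure" and A :: "'a measure"
    and P :: "'s \<times> 'a \<Rightarrow> 's measure" and R :: "'s \<times> 'a \<Rightarrow> 's \<Rightarrow> real"
    and \<pi> :: "'s \<Rightarrow> 'a measure" and \<gamma> :: real
    and Z1 Z2 :: "'s \<times> 'a \<Rightarrow> real measure"
  assumes gamma: "0 < \<gamma>" "\<gamma> < 1"
    and transition_kernel: "P \<in> S \<Otimes>\<^sub>M A \<rightarrow>\<^sub>M prob_algebra S"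
    and policy_kernel: "\<pi> \<in> S \<rightarrow>\<^sub>M prob_algebra A"
    and reward_random_variable:
      "\<And>z. z \<in> space (S \<Otimes>\<^sub>M A) \<Longrightarrow> R z \<in> borel_measurable S"
    and reward_bounded:
      "\<exists>Rmax::real. \<forall>z \<in> space (S \<Otimes>\<^sub>M A). AE s' in P z. \<bar>R z s'\<bar> \<le> Rmax"
    and expectation_measurable:
      "\<And>Z x. return_dist_field S A Z \<Longrightarrow> cdf_field Z \<in> X_cdf S A \<Longrightarrow>
         (\<forall>z \<in> space (S \<Otimes>\<^sub>M A).
            integrable (next_pair_law S A P \<pi> z) (\<lambda>z'. cdf_field Z z' x)) \<and>
         (\<lambda>z. \<integral> z'. cdf_field Z z' x \<partial>next_pair_law S A P \<pi> z) \<in> borel_measurable (S \<Otimes>\<^sub>M A)"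
    and Z1: "return_dist_field S A Z1" "cdf_field Z1 \<in> X_cdf S A"
    and Z2: "return_dist_field S A Z2" "cdf_field Z2 \<in> X_cdf S A"
  shows "d_Cr S A (cdf_bellman S A P R \<pi> \<gamma> (cdf_field Z1)) (cdf_bellman S A P R \<pi> \<gamma> (cdf_field Z2))
           \<le> ennreal (sqrt \<gamma>) * d_Cr S A (cdf_field Z1) (cdf_field Z2)"
proof -
  let ?SA = "S \<Otimes>\<^sub>M A"
  let ?Q = "next_pair_law S A P \<pi>" and ?K = "reward_law P R"
  let ?F1 = "cdf_field Z1" and ?F2 = "cdf_field Z2"
  let ?D = "d_Cr S A ?F1 ?F2"
  define H1 where "H1 = reward_translation P R ?F1"
  define H2 where "H2 = reward_translation P R ?F2"
  \<comment> \<open>From here on every function of the pair alone is measurable.\<close>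
  have Pow: "sets ?SA = Pow (space ?SA)"
    using sets_eq_Pow_if_fields_integrable[OF transition_kernel policy_kernel]
      expectation_measurable by blast
  have K: "real_distribution (?K z)" if "z \<in> space ?SA" for z
  proof -
    have "P z \<in> space (prob_algebra S)"
      using transition_kernel that by (rule measurable_space)
    then have "prob_space (P z)" "R z \<in> borel_measurable (P z)"
      using reward_random_variable[OF that]
      by (auto simp: space_prob_algebra cong: measurable_cong_sets)
    then show ?thesis
      unfolding reward_law_def
      by (simp add: real_distribution_def real_distribution_axioms_def prob_space.prob_space_distr)
  qed
  have K_meas: "?K \<in> ?SA \<rightarrow>\<^sub>M subprob_algebra borel"
    using K by (intro measurableI)
      (auto simp: Pow space_subprob_algebra real_distribution_def real_distribution_axioms_def
        prob_space_imp_subprob_space)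
  \<comment> \<open>Discreteness settles each fixed \<open>x\<close>; joint measurability still
    needs the right continuity of CDFs.\<close>
  have F_meas: "(\<lambda>(z, x). cdf_field Z z x) \<in> borel_measurable (?SA \<Otimes>\<^sub>M borel)"
    if "return_dist_field S A Z" for Z
  proof (rule borel_measurable_pair_right_continuous)
    show "(\<lambda>z. cdf_field Z z x) \<in> borel_measurable ?SA" for x
      by (intro measurableI) (auto simp: Pow)
    show "continuous (at_right x) (cdf_field Z z)" if "z \<in> space ?SA" for z x
      using \<open>return_dist_field S A Z\<close> that
      by (auto simp: return_dist_field_def cdf_field_def real_distribution_def
          intro!: finite_borel_measure.cdf_is_right_cont real_distribution.finite_borel_measure_M)
  qed
  have H_meas: "(\<lambda>(z, x). reward_translation P R (cdf_field Z) z x) \<in> borel_measurable (?SA \<Otimes>\<^sub>M borel)"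
    if "return_dist_field S A Z" for Z
  proof -
    note [measurable] = F_meas[OF that] K_meas
    have "(\<lambda>(p, r). cdf_field Z (fst p) (snd p - r)) \<in> borel_measurable ((?SA \<Otimes>\<^sub>M borel) \<Otimes>\<^sub>M borel)"
      by measurable
    then have "(\<lambda>p. \<integral> r. cdf_field Z (fst p) (snd p - r) \<partial>?K (fst p)) \<in> borel_measurable (?SA \<Otimes>\<^sub>M borel)"
      by (rule integral_measurable_subprob_algebra2) measurable
    then show ?thesis
      by (simp add: reward_translation_def case_prod_beta)
  qed
  have cdf_bounds: "0 \<le> cdf_field Z z x" "cdf_field Z z x \<le> 1"
    if "return_dist_field S A Z" "z \<in> space ?SA" for Z z x
    using that by (auto simp: return_dist_field_def cdf_field_def cdf_def real_distribution_def
        intro: prob_space.prob_le_1)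
  have F_int: "integrable (?K z) (\<lambda>r. cdf_field Z z (x - r))"
    if "return_dist_field S A Z" "z \<in> space ?SA" for Z z x
  proof -
    interpret real_distribution "?K z" using that(2) by (rule K)
    note [measurable] = measurable_compose_Pair1[OF that(2) F_meas[OF that(1)], simplified]
    show ?thesis
      by (rule integrable_const_bound[where B=1]) (auto simp: cdf_bounds[OF that])
  qed
  \<comment> \<open>Together with measurability this gives integrability under the next-pair law, so
    the mean of a difference can be split.\<close>
  have H_bound: "\<bar>reward_translation P R (cdf_field Z) z x\<bar> \<le> 1"
    if "return_dist_field S A Z" "z \<in> space ?SA" for Z z x
  proof -
    interpret real_distribution "?K z" using that(2) by (rule K)
    have "(\<integral> r. cdf_field Z z (x - r) \<partial>?K z) \<le> 1"
      by (intro integral_le_const F_int that) (auto simp: cdf_bounds[OF that])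
    moreover have "0 \<le> (\<integral> r. cdf_field Z z (x - r) \<partial>?K z)"
      by (intro integral_nonneg_AE) (auto simp: cdf_bounds[OF that])
    ultimately show ?thesis
      by (simp add: reward_translation_def)
  qed
  \<comment> \<open>The bound is uniform in \<open>z\<close>, so it survives averaging over next
    pairs.\<close>
  have H_contract: "(\<integral>\<^sup>+ x. ennreal ((H1 z x - H2 z x)\<^sup>2) \<partial>lborel) \<le> ?D\<^sup>2" if z: "z \<in> space ?SA" for z
  proof -
    let ?I = "\<integral>\<^sup>+ x. ennreal ((?F1 z x - ?F2 z x)\<^sup>2) \<partial>lborel"
    note [measurable] = measurable_compose_Pair1[OF z F_meas[OF Z1(1)], simplified]
      measurable_compose_Pair1[OF z F_meas[OF Z2(1)], simplified]
    have "H1 z x - H2 z x = (\<integral> r. ?F1 z (x - r) - ?F2 z (x - r) \<partial>?K z)" for x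
      by (simp add: H1_def H2_def reward_translation_def F_int Z1 Z2 z)
    then have "(\<integral>\<^sup>+ x. ennreal ((H1 z x - H2 z x)\<^sup>2) \<partial>lborel) \<le> ?I"
      using nn_integral_power2_translation_mean_le[OF K[OF z], of "\<lambda>x. ?F1 z x - ?F2 z x"] by simp
    also have "\<dots> = (ennreal_sqrt ?I)\<^sup>2"
      by (simp add: ennreal_sqrt_power2)
    also have "\<dots> \<le> ?D\<^sup>2"
      using z unfolding d_Cr_def by (intro power_mono SUP_upper) auto
    finally show ?thesis .
  qed
  have T_contract: "(\<integral>\<^sup>+ x. ennreal ((cdf_bellman S A P R \<pi> \<gamma> ?F1 z x - cdf_bellman S A P R \<pi> \<gamma> ?F2 z x)\<^sup>2) \<partial>lborel)
      \<le> ennreal \<gamma> * ?D\<^sup>2" (is "?L \<le> _") if z: "z \<in> space ?SA" for z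
  proof -
    have Q: "prob_space (?Q z)" and sets_Q[measurable_cong]: "sets (?Q z) = sets ?SA"
      using next_pair_law_in_prob_algebra[OF transition_kernel policy_kernel z]
      by (auto simp: space_prob_algebra)
    have space_Q: "space (?Q z) = space ?SA"
      using sets_Q by (rule sets_eq_imp_space_eq)
    interpret prob_space "?Q z" by (rule Q)
    \<comment> \<open>The difference of the two Bellman images before rescaling: averaging over next
      pairs acts at fixed \<open>x\<close>, so \<open>x / \<gamma>\<close> can be substituted
      afterwards.\<close>
    define g where "g y = (\<integral> z'. H1 z' y - H2 z' y \<partial>?Q z)" for y
    note [measurable] = H_meas[OF Z1(1), folded H1_def] H_meas[OF Z2(1), folded H2_def]
    have g[measurable]: "g \<in> borel_measurable borel"
      unfolding g_def by measurable
    have int: "integrable (?Q z) (\<lambda>z'. H1 z' y)" "integrable (?Q z) (\<lambda>z'. H2 z' y)" for y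
      by (rule integrable_const_bound[where B=1];
        auto simp: space_Q H1_def H2_def intro!: H_bound Z1 Z2;
        fold H1_def H2_def; measurable)+
    have "cdf_bellman S A P R \<pi> \<gamma> ?F1 z x - cdf_bellman S A P R \<pi> \<gamma> ?F2 z x = g (x / \<gamma>)" for x
      by (simp add: cdf_bellman_def cond_expectation_def discount_scaling_def g_def int
          flip: H1_def H2_def)
    then have "?L = (\<integral>\<^sup>+ x. ennreal ((g (x / \<gamma>))\<^sup>2) \<partial>lborel)"
      by simp
    \<comment> \<open>The Jacobian of \<open>x = \<gamma> * y\<close> is the only source of
      contraction; its square root is the final constant.\<close>
    also have "\<dots> = ennreal \<gamma> * (\<integral>\<^sup>+ y. ennreal ((g y)\<^sup>2) \<partial>lborel)"
      using gamma nn_integral_real_affine[of "\<lambda>x. ennreal ((g (x / \<gamma>))\<^sup>2)" \<gamma> 0] by simp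
    also have "\<dots> \<le> ennreal \<gamma> * (\<integral>\<^sup>+ z'. (\<integral>\<^sup>+ y. ennreal ((H1 z' y - H2 z' y)\<^sup>2) \<partial>lborel) \<partial>?Q z)"
      unfolding g_def by (intro mult_left_mono nn_integral_power2_mean_le Q) auto
    also have "\<dots> \<le> ennreal \<gamma> * (\<integral>\<^sup>+ z'. ?D\<^sup>2 \<partial>?Q z)"
      by (intro mult_left_mono nn_integral_mono H_contract) (auto simp: space_Q)
    finally show ?thesis
      by (simp add: emeasure_space_1)
  qed
  show ?thesis
    unfolding d_Cr_def[of S A "cdf_bellman S A P R \<pi> \<gamma> ?F1"]
    using ennreal_sqrt_mono[OF T_contract]
    by (intro SUP_least) (simp add: ennreal_sqrt_mult_power2 gamma)
qed

end
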